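(* Every compact metric space admits a compensation function.
   Context: For a compact Hausdorff space $K$, $\mathcal{M}(K)=C(K)^*$ denotes the space of regular Borel signed (real) measures on $K$, $\omega^*$ its weak$^*$ topology, and $\mu^+$ the positive part of $\mu\in\mathcal{M}(K)$. $\nu\in\mathcal{M}(K)$ is a compensation of $\mu\in\mathcal{M}(K)$ if: $0\le\nu\le\mu^+$ and $\nu(K)=\mu(K)$ in case $\mu(K)>0$; and $\nu=0$ in case $\mu(K)\le 0$. A compensation function for $K$ is an $\omega^*$-$\omega^*$-continuous map $\xi\colon\mathcal{M}(K)\to\mathcal{M}(K)$ such that $\xi(\mu)$ is a compensation of $\mu$ for every $\mu\in\mathcal{M}(K)$; $K$ admits a compensation function if such a map exists. *)

theory Defs
  imports "HOL-Analysis.Analysis"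
begin

text \<open>
  A compact Hausdorff space is given as a compact subset \<open>K\<close> of a Hausdorff type, with the subspace
  topology. Its Borel sets are \<open>sets (restrict_space borel K)\<close>. A signed measure on \<open>K\<close> is
  represented by a real function on all sets that is 0 outside the Borel sets of \<open>K\<close>, so that
  equality of functions is equality of signed measures.
\<close>

abbreviation borel_sets :: "'a::topological_space set \<Rightarrow> 'a set set" where
  "borel_sets K \<equiv> sets (restrict_space borel K)"

(* Countable additivity also yields \<mu> {} = 0: a constant sequence is summable only if it is 0. *)
definition signed_borel_measure :: "'a::topological_space set \<Rightarrow> ('a set \<Rightarrow> real) \<Rightarrow> bool" where
  "signed_borel_measure K \<mu> \<longleftrightarrow>
     (\<forall>A. A \<notin> borel_sets K \<longrightarrow> \<mu> A = 0) \<and>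
     (\<forall>A::nat \<Rightarrow> 'a set. range A \<subseteq> borel_sets K \<longrightarrow> disjoint_family A \<longrightarrow>
        (\<lambda>n. \<mu> (A n)) sums \<mu> (\<Union>n. A n))"

(* The set below is bounded for every signed measure, so the supremum is a genuine one. *)
definition positive_part :: "'a::topological_space set \<Rightarrow> ('a set \<Rightarrow> real) \<Rightarrow> 'a set \<Rightarrow> real" where
  "positive_part K \<mu> A =
     (if A \<in> borel_sets K then Sup {\<mu> B | B. B \<in> borel_sets K \<and> B \<subseteq> A} else 0)"

definition negative_part :: "'a::topological_space set \<Rightarrow> ('a set \<Rightarrow> real) \<Rightarrow> 'a set \<Rightarrow> real" where
  "negative_part K \<mu> = positive_part K (\<lambda>A. - \<mu> A)"

definition total_variation :: "'a::topological_space set \<Rightarrow> ('a set \<Rightarrow> real) \<Rightarrow> 'a set \<Rightarrow> real" where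
  "total_variation K \<mu> A = positive_part K \<mu> A + negative_part K \<mu> A"

definition regular_signed :: "'a::t2_space set \<Rightarrow> ('a set \<Rightarrow> real) \<Rightarrow> bool" where
  "regular_signed K \<mu> \<longleftrightarrow>
     (\<forall>A\<in>borel_sets K.
        total_variation K \<mu> A = Sup {total_variation K \<mu> C | C. compact C \<and> C \<subseteq> A} \<and>
        total_variation K \<mu> A =
          Inf {total_variation K \<mu> U | U. openin (top_of_set K) U \<and> A \<subseteq> U})"

definition regular_measures :: "'a::t2_space set \<Rightarrow> ('a set \<Rightarrow> real) set" where
  "regular_measures K = {\<mu>. signed_borel_measure K \<mu> \<and> regular_signed K \<mu>}"

(* For nonnegative \<nu> only: ennreal truncates negative values. *)
definition to_measure :: "'a::topological_space set \<Rightarrow> ('a set \<Rightarrow> real) \<Rightarrow> 'a measure" where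
  "to_measure K \<nu> = measure_of K (borel_sets K) (\<lambda>A. ennreal (\<nu> A))"

definition signed_integral ::
  "'a::topological_space set \<Rightarrow> ('a set \<Rightarrow> real) \<Rightarrow> ('a \<Rightarrow> real) \<Rightarrow> real" where
  "signed_integral K \<mu> f =
     (\<integral>x. f x \<partial>to_measure K (positive_part K \<mu>)) - (\<integral>x. f x \<partial>to_measure K (negative_part K \<mu>))"

text \<open>
  The weak* topology is the initial topology for the maps \<open>\<mu> \<mapsto> \<integral>f d\<mu>\<close> with \<open>f\<close> continuous on \<open>K\<close>.
  Functions that agree on \<open>K\<close> index the same map, so repeating them does not change the topology.
\<close>

definition weak_star :: "'a::t2_space set \<Rightarrow> ('a set \<Rightarrow> real) topology" where
  "weak_star K =
     pullback_topology (regular_measures K)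
       (\<lambda>\<mu>. \<lambda>f\<in>{f. continuous_on K f}. signed_integral K \<mu> f)
       (powertop_real {f. continuous_on K f})"

definition is_compensation ::
  "'a::t2_space set \<Rightarrow> ('a set \<Rightarrow> real) \<Rightarrow> ('a set \<Rightarrow> real) \<Rightarrow> bool" where
  "is_compensation K \<mu> \<nu> \<longleftrightarrow>
     \<nu> \<in> regular_measures K \<and>
     (if \<mu> K > 0
      then (\<forall>A\<in>borel_sets K. 0 \<le> \<nu> A \<and> \<nu> A \<le> positive_part K \<mu> A) \<and> \<nu> K = \<mu> K
      else \<nu> = (\<lambda>_. 0))"

definition compensation_function ::
  "'a::t2_space set \<Rightarrow> (('a set \<Rightarrow> real) \<Rightarrow> ('a set \<Rightarrow> real)) \<Rightarrow> bool" where
  "compensation_function K \<xi> \<longleftrightarrow>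
     continuous_map (weak_star K) (weak_star K) \<xi> \<and>
     (\<forall>\<mu>\<in>regular_measures K. is_compensation K \<mu> (\<xi> \<mu>))"

definition admits_compensation_function :: "'a::t2_space set \<Rightarrow> bool" where
  "admits_compensation_function K \<longleftrightarrow> (\<exists>\<xi>. compensation_function K \<xi>)"

end

theory Submission
  imports Defs
begin

text \<open>
  Multiply functions \<open>q\<close> and \<open>1 - q\<close> along the branches of the binary tree, with \<open>q\<close> running through
  a sequence that separates the points of \<open>K\<close>. Each level of the tree is a partition of unity, and
  the supports shrink uniformly as the level grows. Starting with mass \<open>max 0 (\<mu> K)\<close> at the root,
  split the mass of every node greedily: the left child receives as much as
  \<open>max 0 (\<integral>w d\<mu>)\<close> allows, where \<open>w\<close> is the weight function of that child, and the right child
  receives the rest. Since positive parts are subadditive, no node exceeds its bound, and all node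
  masses are weak* continuous in \<open>\<mu>\<close> because only \<open>min\<close>, \<open>max\<close> and subtraction are used. Placing the
  masses of level \<open>n\<close> at points of the supports gives discrete measures that converge to a measure
  below \<open>\<mu>\<^sup>+\<close>; for a fixed test function the convergence is uniform relative to \<open>max 0 (\<mu> K)\<close>,
  so the limit is again continuous in \<open>\<mu>\<close>.
\<close>

section \<open>Jordan decomposition of signed measures\<close>

lemma borel_sets_subset: "A \<in> borel_sets K \<Longrightarrow> A \<subseteq> K"
  by (metis sets.sets_into_space space_restrict_space2 space_restrict_space space_borel Int_UNIV_right)

lemma space_borel_sets: "space (restrict_space borel K) = K"
  by (simp add: space_restrict_space)

lemma borel_sets_self: "K \<in> borel_sets K"
  using sets.top[of "restrict_space borel K"] by (simp add: space_borel_sets)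

lemma sets_eq_borel_sets_imp_space: "sets N = borel_sets K \<Longrightarrow> space N = K"
  by (metis sets_eq_imp_space_eq space_borel_sets)

section \<open>Finite nonnegative measures as signed measures\<close>

lemma to_measure_measure:
  assumes "finite_measure N" "sets N = borel_sets K"
  shows "to_measure K (measure N) = N"
proof -
  interpret finite_measure N by fact
  have sp: "space N = K" by (rule sets_eq_borel_sets_imp_space[OF assms(2)])
  have "(\<lambda>A. ennreal (measure N A)) = emeasure N"
    by (rule ext) (rule emeasure_eq_measure[symmetric])
  then show ?thesis
    using measure_of_of_measure[of N] by (simp add: to_measure_def sp assms(2))
qed

lemma positive_part_measure:
  assumes "finite_measure N" "sets N = borel_sets K"
  shows "positive_part K (measure N) = measure N"
proof
  interpret finite_measure N by fact
  fix A
  show "positive_part K (measure N) A = measure N A"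
  proof (cases "A \<in> borel_sets K")
    case True
    have "Sup {measure N B | B. B \<in> borel_sets K \<and> B \<subseteq> A} = measure N A"
      by (rule cSup_eq_maximum) (use True assms(2) in \<open>auto intro: finite_measure_mono\<close>)
    with True show ?thesis by (simp add: positive_part_def)
  next
    case False
    then show ?thesis by (simp add: positive_part_def measure_notin_sets assms(2))
  qed
qed

lemma negative_part_measure:
  assumes "finite_measure N" "sets N = borel_sets K"
  shows "negative_part K (measure N) = (\<lambda>_. 0)"
proof
  fix A
  have "Sup {- measure N B | B. B \<in> borel_sets K \<and> B \<subseteq> A} = 0"
    by (rule cSup_eq_maximum) (auto intro!: exI[of _ "{}"])
  then show "negative_part K (measure N) A = 0"
    by (simp add: negative_part_def positive_part_def)
qed

lemma signed_borel_measure_measure: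
  assumes "finite_measure N" "sets N = borel_sets K"
  shows "signed_borel_measure K (measure N)"
  unfolding signed_borel_measure_def
  using finite_measure.finite_measure_UNION[OF assms(1)] assms(2)
  by (auto simp: measure_notin_sets)

lemma to_measure_zero: "to_measure K (\<lambda>_. 0) = null_measure (restrict_space borel K)"
proof -
  have "finite_measure (null_measure (restrict_space borel K))"
    by (rule finite_measureI) simp
  from to_measure_measure[OF this, of K]
  have "to_measure K (measure (null_measure (restrict_space borel K))) = null_measure (restrict_space borel K)"
    by simp
  also have "measure (null_measure (restrict_space borel K)) = (\<lambda>_. 0)"
    by (rule ext) (simp add: measure_def)
  finally show ?thesis .
qed

lemma signed_integral_measure:
  assumes "finite_measure N" "sets N = borel_sets K"
  shows "signed_integral K (measure N) f = (\<integral>x. f x \<partial>N)"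
proof -
  have "(\<integral>x. f x \<partial>null_measure (restrict_space borel K)) = (0::real)"
    by (subst integral_null_measure) simp
  then show ?thesis
    using assms by (simp add: signed_integral_def positive_part_measure negative_part_measure
      to_measure_measure to_measure_zero)
qed

section \<open>The positive part of a signed measure is a finite measure\<close>

lemma signed_borel_measure_uminus:
  "signed_borel_measure K \<mu> \<Longrightarrow> signed_borel_measure K (\<lambda>A. - \<mu> A)"
  unfolding signed_borel_measure_def by (auto intro!: sums_minus)

context
  fixes K :: "'a::topological_space set" and \<mu> :: "'a set \<Rightarrow> real"
  assumes \<mu>: "signed_borel_measure K \<mu>"
begin

lemma signed_sums:
  "range A \<subseteq> borel_sets K \<Longrightarrow> disjoint_family A \<Longrightarrow> (\<lambda>n. \<mu> (A n)) sums \<mu> (\<Union>n. A n)"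
  using \<mu> by (auto simp: signed_borel_measure_def)

lemma signed_empty: "\<mu> {} = 0"
proof -
  have "(\<lambda>n::nat. \<mu> {}) sums \<mu> {}"
    using signed_sums[of "\<lambda>_. {}"] by (auto simp: disjoint_family_on_def)
  from summable_LIMSEQ_zero[OF sums_summable[OF this]] show ?thesis
    by (simp add: LIMSEQ_const_iff)
qed

lemma signed_Un:
  assumes "A \<in> borel_sets K" "B \<in> borel_sets K" "A \<inter> B = {}"
  shows "\<mu> (A \<union> B) = \<mu> A + \<mu> B"
proof -
  have "(\<lambda>n. \<mu> (binaryset A B n)) sums \<mu> (\<Union>n. binaryset A B n)"
    by (rule signed_sums) (use assms in \<open>auto simp: range_binaryset_eq binaryset_def disjoint_family_on_def\<close>)
  moreover have "(\<lambda>n. \<mu> (binaryset A B n)) sums (\<mu> A + \<mu> B)"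
    by (rule binaryset_sums) (rule signed_empty)
  ultimately show ?thesis
    by (simp add: UN_binaryset_eq sums_unique2)
qed

lemma signed_Diff:
  assumes "A \<in> borel_sets K" "B \<in> borel_sets K" "B \<subseteq> A"
  shows "\<mu> (A - B) = \<mu> A - \<mu> B"
  using signed_Un[of "A - B" B] assms by (simp add: Un_absorb2 sets.Diff Int_commute[of _ B])

text \<open>
  A set on which \<open>\<mu>\<close> is unbounded can be split into two parts of large measure, one of which is
  again unbounded; iterating yields disjoint sets contradicting countable additivity.
\<close>

lemma signed_bounded: "\<exists>b. \<forall>B\<in>borel_sets K. \<bar>\<mu> B\<bar> \<le> b"
proof (rule ccontr)
  define unb where
    "unb A \<longleftrightarrow> A \<in> borel_sets K \<and> (\<forall>b. \<exists>B\<in>borel_sets K. B \<subseteq> A \<and> \<bar>\<mu> B\<bar> > b)" for A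
  assume "\<not> ?thesis"
  then have K: "unb K"
    unfolding unb_def by (metis borel_sets_self borel_sets_subset not_le)
  have step: "\<exists>B. unb B \<and> B \<subseteq> A \<and> \<bar>\<mu> (A - B)\<bar> \<ge> 1" if A: "unb A" for A
  proof -
    \<comment> \<open>The margin \<open>\<bar>\<mu> A\<bar> + 1\<close> gives both \<open>B\<close>
      and \<open>A - B\<close> a measure of absolute value at least 1. So whichever of the two stays
      unbounded, the other one may be discarded.\<close>
    from A obtain B where B: "B \<in> borel_sets K" "B \<subseteq> A" "\<bar>\<mu> B\<bar> > \<bar>\<mu> A\<bar> + 1"
      unfolding unb_def by metis
    have AK: "A \<in> borel_sets K" using A by (simp add: unb_def)
    have d: "\<mu> (A - B) = \<mu> A - \<mu> B" using signed_Diff AK B by blast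
    \<comment> \<open>Every Borel subset of \<open>A\<close> is cut by \<open>B\<close> into two
      pieces, so bounds on both pieces would add up to a bound on \<open>A\<close>.\<close>
    have "unb B \<or> unb (A - B)"
    proof (rule ccontr)
      assume "\<not> (unb B \<or> unb (A - B))"
      then obtain b b' where
        b: "\<And>C. C \<in> borel_sets K \<Longrightarrow> C \<subseteq> B \<Longrightarrow> \<bar>\<mu> C\<bar> \<le> b" and
        b': "\<And>C. C \<in> borel_sets K \<Longrightarrow> C \<subseteq> A - B \<Longrightarrow> \<bar>\<mu> C\<bar> \<le> b'"
        unfolding unb_def using B AK sets.Diff[OF AK B(1)] by (meson not_le)
      from A obtain C where C: "C \<in> borel_sets K" "C \<subseteq> A" "\<bar>\<mu> C\<bar> > b + b'"
        unfolding unb_def by metis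
      have "\<mu> C = \<mu> (C \<inter> B) + \<mu> (C - B)"
        using signed_Un[of "C \<inter> B" "C - B"] C B by (auto simp: Int_Diff_Un)
      moreover have "\<bar>\<mu> (C \<inter> B)\<bar> \<le> b" "\<bar>\<mu> (C - B)\<bar> \<le> b'"
        using b[of "C \<inter> B"] b'[of "C - B"] C B by auto
      ultimately show False using C(3) by linarith
    qed
    then show ?thesis
    proof
      assume "unb B"
      then show ?thesis using B d by (intro exI[of _ B]) auto
    next
      assume "unb (A - B)"
      moreover have "A - (A - B) = B" using B by auto
      ultimately show ?thesis using B by (intro exI[of _ "A - B"]) auto
    qed
  qed
  then obtain S where S: "\<And>A. unb A \<Longrightarrow> unb (S A) \<and> S A \<subseteq> A \<and> \<bar>\<mu> (A - S A)\<bar> \<ge> 1"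
    by metis
  define A where "A n = (S ^^ n) K" for n
  have A: "unb (A n)" for n
    by (induction n) (use K S in \<open>auto simp: A_def\<close>)
  have Suc: "A (Suc n) = S (A n)" for n by (simp add: A_def)
  have dec: "decseq A"
    by (rule decseq_SucI) (use A S Suc in auto)
  have "disjoint_family (\<lambda>n. A n - A (Suc n))"
  proof -
    have "(A m - A (Suc m)) \<inter> (A n - A (Suc n)) = {}" if "m < n" for m n
      using decseqD[OF dec, of "Suc m" n] that by auto
    then show ?thesis
      unfolding disjoint_family_on_def by (metis Int_commute nat_neq_iff)
  qed
  moreover have "range (\<lambda>n. A n - A (Suc n)) \<subseteq> borel_sets K"
    using A unfolding unb_def by (auto intro!: sets.Diff)
  ultimately have "(\<lambda>n. \<mu> (A n - A (Suc n))) \<longlonglongrightarrow> 0"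
    using signed_sums sums_summable summable_LIMSEQ_zero by blast
  then have "\<forall>\<^sub>F n in sequentially. \<bar>\<mu> (A n - A (Suc n))\<bar> < 1"
    by (auto dest: order_tendstoD(2)[OF tendsto_rabs_zero, of _ _ 1])
  then obtain n where "\<bar>\<mu> (A n - A (Suc n))\<bar> < 1"
    by (auto simp: eventually_sequentially)
  then show False using S[OF A[of n]] Suc[of n] by auto
qed

lemma positive_part_bdd:
  "bdd_above {\<mu> B | B. B \<in> borel_sets K \<and> B \<subseteq> A}"
proof -
  obtain b where "\<forall>B\<in>borel_sets K. \<bar>\<mu> B\<bar> \<le> b" using signed_bounded by blast
  then show ?thesis by (auto intro!: bdd_aboveI[of _ b] dest: abs_le_D1)
qed

lemma positive_part_upper:
  assumes "A \<in> borel_sets K" "B \<in> borel_sets K" "B \<subseteq> A"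
  shows "\<mu> B \<le> positive_part K \<mu> A"
  using assms cSup_upper[OF _ positive_part_bdd, of "\<mu> B" A] by (auto simp: positive_part_def)

lemma positive_part_least:
  assumes "A \<in> borel_sets K" "\<And>B. B \<in> borel_sets K \<Longrightarrow> B \<subseteq> A \<Longrightarrow> \<mu> B \<le> c"
  shows "positive_part K \<mu> A \<le> c"
proof -
  have "Sup {\<mu> B | B. B \<in> borel_sets K \<and> B \<subseteq> A} \<le> c"
    by (rule cSup_least) (use assms in auto)
  then show ?thesis using assms(1) by (simp add: positive_part_def)
qed

lemma positive_part_nonneg: "0 \<le> positive_part K \<mu> A"
proof (cases "A \<in> borel_sets K")
  case True
  with positive_part_upper[of A "{}"] show ?thesis by (simp add: signed_empty)
qed (simp add: positive_part_def)

text \<open>Subsets of \<open>A\<close> and of \<open>B\<close> can be chosen independently, so the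
  suprema are taken one after the other, first with the subset of \<open>B\<close> fixed.
  Superadditivity suffices for \<open>positive_part_sums\<close>; the opposite estimate comes from
  countable additivity of \<mu> there.\<close>

lemma positive_part_Un:
  assumes "A \<in> borel_sets K" "B \<in> borel_sets K" "A \<inter> B = {}"
  shows "positive_part K \<mu> A + positive_part K \<mu> B \<le> positive_part K \<mu> (A \<union> B)"
proof -
  have *: "\<mu> C + \<mu> D \<le> positive_part K \<mu> (A \<union> B)"
    if "C \<in> borel_sets K" "C \<subseteq> A" "D \<in> borel_sets K" "D \<subseteq> B" for C D
  proof -
    have "C \<inter> D = {}" using that assms by auto
    then show ?thesis
      using positive_part_upper[of "A \<union> B" "C \<union> D"] signed_Un[of C D] that assms by auto
  qed
  have "positive_part K \<mu> A \<le> positive_part K \<mu> (A \<union> B) - \<mu> D"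
    if "D \<in> borel_sets K" "D \<subseteq> B" for D
    using positive_part_least[OF assms(1), of "positive_part K \<mu> (A \<union> B) - \<mu> D"] *[OF _ _ that]
    by (simp add: le_diff_eq)
  then have "positive_part K \<mu> B \<le> positive_part K \<mu> (A \<union> B) - positive_part K \<mu> A"
    by (intro positive_part_least[OF assms(2)]) (simp add: le_diff_eq add.commute)
  then show ?thesis by simp
qed

lemma positive_part_mono:
  assumes "A \<in> borel_sets K" "B \<in> borel_sets K" "A \<subseteq> B"
  shows "positive_part K \<mu> A \<le> positive_part K \<mu> B"
  by (rule positive_part_least) (use assms positive_part_upper in auto)

text \<open>Finite superadditivity and monotonicity bound the partial sums from above. Conversely, a
  Borel set \<open>B\<close> inside the union is cut along the \<open>A n\<close>, and \<mu> of each
  piece is at most the positive part of \<open>A n\<close>.\<close>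

lemma positive_part_sums:
  assumes A: "range A \<subseteq> borel_sets K" "disjoint_family A"
  shows "(\<lambda>n. positive_part K \<mu> (A n)) sums positive_part K \<mu> (\<Union>n. A n)"
proof -
  let ?P = "positive_part K \<mu>"
  have U: "(\<Union>n. A n) \<in> borel_sets K" using A by auto
  have An: "A n \<in> borel_sets K" for n using A by auto
  have fin: "(\<Sum>i<n. ?P (A i)) \<le> ?P (\<Union>i<n. A i)" for n
  proof (induction n)
    case 0
    show ?case using positive_part_nonneg by simp
  next
    case (Suc n)
    have "A i \<inter> A n = {}" if "i < n" for i
      using disjoint_family_onD[OF A(2), of i n] that by simp
    then have "(\<Union>i<n. A i) \<inter> A n = {}" by blast
    then have "?P (\<Union>i<n. A i) + ?P (A n) \<le> ?P ((\<Union>i<n. A i) \<union> A n)"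
      using An by (intro positive_part_Un) auto
    also have "(\<Union>i<n. A i) \<union> A n = (\<Union>i<Suc n. A i)" by (auto simp: lessThan_Suc)
    finally show ?case using Suc by simp
  qed
  have le: "(\<Sum>i<n. ?P (A i)) \<le> ?P (\<Union>i. A i)" for n
  proof -
    have "?P (\<Union>i<n. A i) \<le> ?P (\<Union>i. A i)"
      by (rule positive_part_mono) (use An in auto)
    with fin[of n] show ?thesis by linarith
  qed
  then have sm: "summable (\<lambda>n. ?P (A n))"
    by (intro summableI_nonneg_bounded positive_part_nonneg)
  have "?P (\<Union>n. A n) \<le> (\<Sum>n. ?P (A n))"
  proof (rule positive_part_least[OF U])
    fix B assume B: "B \<in> borel_sets K" "B \<subseteq> (\<Union>n. A n)"
    have "(\<lambda>n. \<mu> (B \<inter> A n)) sums \<mu> (\<Union>n. B \<inter> A n)"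
      by (rule signed_sums) (use A B in \<open>auto simp: disjoint_family_on_def\<close>)
    also have "(\<Union>n. B \<inter> A n) = B" using B by auto
    finally have s: "(\<lambda>n. \<mu> (B \<inter> A n)) sums \<mu> B" .
    show "\<mu> B \<le> (\<Sum>n. ?P (A n))"
      by (rule sums_le[OF _ s summable_sums[OF sm]])
        (use An B in \<open>auto intro: positive_part_upper\<close>)
  qed
  moreover have "(\<Sum>n. ?P (A n)) \<le> ?P (\<Union>n. A n)"
    by (rule suminf_le_const[OF sm le])
  ultimately show ?thesis using sm by (simp add: sums_iff)
qed

text \<open>\<open>measure_of\<close> returns the given set function only if that function is
  positive and countably additive, which is what has to be checked here.\<close>

lemma positive_part_is_measure:
  defines "P \<equiv> to_measure K (positive_part K \<mu>)"
  shows "sets P = borel_sets K" "finite_measure P" "measure P = positive_part K \<mu>"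
proof -
  let ?P = "positive_part K \<mu>"
  have sa: "sigma_algebra K (borel_sets K)"
    using sets.sigma_algebra_axioms[of "restrict_space borel K"] by (simp add: space_borel_sets)
  show s: "sets P = borel_sets K"
    unfolding P_def to_measure_def using sigma_algebra.sets_measure_of_eq[OF sa] by simp
  have sp: "space P = K" using s by (rule sets_eq_borel_sets_imp_space)
  have e0: "?P {} = 0"
    using positive_part_least[of "{}" 0] positive_part_nonneg[of "{}"] signed_empty by force
  have em: "emeasure P A = ennreal (?P A)" if "A \<in> borel_sets K" for A
    unfolding P_def to_measure_def
  proof (rule emeasure_measure_of_sigma[OF sa _ _ that])
    show "positive (borel_sets K) (\<lambda>A. ennreal (?P A))" by (simp add: positive_def e0)
    show "countably_additive (borel_sets K) (\<lambda>A. ennreal (?P A))"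
      unfolding countably_additive_def
    proof (intro allI impI)
      fix A :: "nat \<Rightarrow> _"
      assume A: "range A \<subseteq> borel_sets K" "disjoint_family A"
      show "(\<Sum>n. ennreal (?P (A n))) = ennreal (?P (\<Union>n. A n))"
        using positive_part_sums[OF A] positive_part_nonneg
        by (simp add: suminf_ennreal2 sums_iff)
    qed
  qed
  show "finite_measure P"
    by (rule finite_measureI) (use em[OF borel_sets_self] sp in simp)
  show "measure P = ?P"
  proof
    fix A show "measure P A = ?P A"
    proof (cases "A \<in> borel_sets K")
      case True
      with em show ?thesis by (simp add: measure_def positive_part_nonneg)
    next
      case False
      then show ?thesis by (simp add: measure_notin_sets s positive_part_def)
    qed
  qed
qed

end

text \<open>The Jordan decomposition: replacing \<open>B\<close> by \<open>A - B\<close> turns the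
  supremum for one part into the supremum for the other.\<close>

lemma negative_part_eq:
  assumes \<mu>: "signed_borel_measure K \<mu>" and A: "A \<in> borel_sets K"
  shows "negative_part K \<mu> A = positive_part K \<mu> A - \<mu> A"
proof (rule antisym)
  note \<mu>' = signed_borel_measure_uminus[OF \<mu>]
  show "negative_part K \<mu> A \<le> positive_part K \<mu> A - \<mu> A"
    unfolding negative_part_def
  proof (rule positive_part_least[OF \<mu>' A])
    fix B assume B: "B \<in> borel_sets K" "B \<subseteq> A"
    show "- \<mu> B \<le> positive_part K \<mu> A - \<mu> A"
      using positive_part_upper[OF \<mu> A, of "A - B"] signed_Diff[OF \<mu> A B] A B by auto
  qed
  have "positive_part K \<mu> A \<le> negative_part K \<mu> A + \<mu> A"
  proof (rule positive_part_least[OF \<mu> A])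
    fix B assume B: "B \<in> borel_sets K" "B \<subseteq> A"
    show "\<mu> B \<le> negative_part K \<mu> A + \<mu> A"
      using positive_part_upper[OF \<mu>' A, of "A - B"] signed_Diff[OF \<mu> A B] A B
      unfolding negative_part_def by auto
  qed
  then show "positive_part K \<mu> A - \<mu> A \<le> negative_part K \<mu> A" by simp
qed

section \<open>Measures from masses on a binary tree\<close>

lemma sum_double: "(\<Sum>i<2 * j. h i) = (\<Sum>i<j. h (2 * i) + h (Suc (2 * i)))"
  for h :: "nat \<Rightarrow> 'b::comm_monoid_add" and j :: nat
  by (induction j) (simp_all add: ac_simps)

text \<open>\<open>F n j\<close> is meant as the left endpoint of interval \<open>j\<close> on level
  \<open>n\<close>, that is, the mass of the nodes before \<open>j\<close>. The recursion descends
  to the interval containing \<open>t\<close> by comparing \<open>t\<close> with the common endpoint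
  of the two children.\<close>

primrec branch :: "(nat \<Rightarrow> nat \<Rightarrow> real) \<Rightarrow> nat \<Rightarrow> real \<Rightarrow> nat" where
  "branch F 0 t = 0"
| "branch F (Suc n) t =
     (if t < F (Suc n) (Suc (2 * branch F n t)) then 2 * branch F n t else Suc (2 * branch F n t))"

lemma branch_Suc_div: "branch F (Suc n) t div 2 = branch F n t"
  by simp

text \<open>Halving an index moves to the parent, so the quotient by \<open>2 ^ (k - n)\<close> is
  the ancestor on level \<open>n\<close>: the nodes selected by \<open>t\<close> form one branch of
  the tree.\<close>

lemma branch_div: "n \<le> k \<Longrightarrow> branch F k t div 2 ^ (k - n) = branch F n t"
proof (induction k)
  case (Suc k)
  show ?case
  proof (cases "n \<le> k")
    case True
    have "branch F (Suc k) t div 2 ^ (Suc k - n) = branch F (Suc k) t div 2 div 2 ^ (k - n)"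
      using True by (simp add: Suc_diff_le div_mult2_eq del: branch.simps)
    with True Suc show ?thesis by (simp only: branch_Suc_div)
  next
    case False
    with Suc.prems have "n = Suc k" by simp
    then show ?thesis by simp
  qed
qed simp

lemma branch_less: "branch F n t < 2 ^ n"
  by (induction n) auto

lemma branch_measurable [measurable]: "branch F n \<in> borel \<rightarrow>\<^sub>M count_space UNIV"
proof (induction n)
  case 0
  show ?case by (simp add: branch.simps(1)[abs_def])
next
  case (Suc n)
  note [measurable] = Suc
  have [measurable]: "(\<lambda>t. F (Suc n) (Suc (2 * branch F n t))) \<in> borel_measurable borel"
    by (rule measurable_compose[OF Suc]) simp
  have [measurable]: "(\<lambda>t. 2 * branch F n t) \<in> borel \<rightarrow>\<^sub>M count_space UNIV"
    by (rule measurable_compose[OF Suc]) simp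
  have [measurable]: "(\<lambda>t. Suc (2 * branch F n t)) \<in> borel \<rightarrow>\<^sub>M count_space UNIV"
    by (rule measurable_compose[OF Suc]) simp
  show ?case by (subst branch.simps(2)[abs_def]) measurable
qed

text \<open>
  A consistent family of masses on the binary tree, where node \<open>j\<close> of level \<open>n\<close> has the children
  \<open>2 * j\<close> and \<open>2 * j + 1\<close> on level \<open>n + 1\<close>, corresponds to nested partitions of the interval
  \<open>[0, g 0 0)\<close>. Sending \<open>t\<close> to the limit of the points attached to the intervals that contain \<open>t\<close>
  transports Lebesgue measure to \<open>K\<close>.
\<close>

lemma tree_measure:
  fixes K :: "'a::metric_space set" and g :: "nat \<Rightarrow> nat \<Rightarrow> real" and z :: "nat \<Rightarrow> nat \<Rightarrow> 'a"
  assumes K: "compact K"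
    and nonneg: "\<And>n j. 0 \<le> g n j"
    and splits: "\<And>n j. g (Suc n) (2 * j) + g (Suc n) (Suc (2 * j)) = g n j"
    and zK: "\<And>n j. 0 < g n j \<Longrightarrow> z n j \<in> K"
    and near: "\<And>e. 0 < e \<Longrightarrow> \<exists>n. \<forall>k\<ge>n. \<forall>j. 0 < g k j \<longrightarrow> dist (z k j) (z n (j div 2 ^ (k - n))) \<le> e"
  obtains N where "finite_measure N" "sets N = borel_sets K"
    "\<And>n d e f. continuous_on K f \<Longrightarrow>
      (\<And>k j. k \<ge> n \<Longrightarrow> 0 < g k j \<Longrightarrow> dist (z k j) (z n (j div 2 ^ (k - n))) \<le> d) \<Longrightarrow>
      (\<And>x y. x \<in> K \<Longrightarrow> y \<in> K \<Longrightarrow> dist x y \<le> d \<Longrightarrow> \<bar>f x - f y\<bar> \<le> e) \<Longrightarrow>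
      \<bar>(\<integral>x. f x \<partial>N) - (\<Sum>j<2 ^ n. g n j * f (z n j))\<bar> \<le> e * g 0 0"
proof -
  define F where "F n j = (\<Sum>i<j. g n i)" for n j
  \<comment> \<open>Level \<open>n + 1\<close> refines level \<open>n\<close>: its endpoints with
    even index are the endpoints of level \<open>n\<close>.\<close>
  have F_double: "F (Suc n) (2 * j) = F n j" for n j
    by (simp add: F_def sum_double splits)
  have F_Suc: "F n (Suc j) = F n j + g n j" for n j
    by (simp add: F_def)
  have F_mono: "F n i \<le> F n j" if "i \<le> j" for n i j
    unfolding F_def using that by (intro sum_mono2) (auto simp: nonneg)
  have F_top: "F n (2 ^ n) = g 0 0" for n
  proof (induction n)
    case 0
    show ?case by (simp add: F_def)
  next
    case (Suc n)
    with F_double[of n "2 ^ n"] show ?case by simp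
  qed
  define M where "M = g 0 0"
  have M0: "0 \<le> M" by (simp add: M_def nonneg)
  define J where "J = branch F"
  define L where "L = restrict_space lborel {0..<M}"
  have spL: "space L = {0..<M}" by (simp add: L_def space_restrict_space)
  interpret L: finite_measure L
    by (rule finite_measureI) (simp add: spL L_def emeasure_restrict_space M0)
  have measL: "measure L (space L) = M"
    by (simp add: spL L_def measure_restrict_space M0)
  have J_in: "F n (J n t) \<le> t \<and> t < F n (Suc (J n t))" if t: "t \<in> {0..<M}" for n t
  proof (induction n)
    case 0
    with t show ?case by (simp add: J_def F_def M_def)
  next
    case (Suc n)
    have "F (Suc n) (2 * J n t) \<le> t" "t < F (Suc n) (Suc (Suc (2 * J n t)))"
      using Suc F_double[of n "Suc (J n t)"] by (simp_all add: F_double)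
    then show ?case by (auto simp: J_def not_less)
  qed
  have J_unique: "J n t = j" if t: "t \<in> {0..<M}" and j: "F n j \<le> t" "t < F n (Suc j)" for n t j
  proof (rule ccontr)
    assume "J n t \<noteq> j"
    then consider "Suc (J n t) \<le> j" | "Suc j \<le> J n t" by linarith
    then show False
      using J_in[OF t, of n] j F_mono by cases (meson le_less_trans less_le_trans not_le order.trans)+
  qed
  \<comment> \<open>The intervals are half-open, so one that contains \<open>t\<close> has positive
    length. Hence the points \<open>z n j\<close> matter only at nodes of positive mass, where they
    are known to lie in \<open>K\<close>.\<close>
  have g_pos: "0 < g n (J n t)" if "t \<in> {0..<M}" for n t
    using J_in[OF that, of n] by (simp add: F_Suc)
  define X where "X n t = z n (J n t)" for n t
  have XK: "X n t \<in> K" if "t \<in> {0..<M}" for n t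
    using g_pos[OF that] zK by (simp add: X_def)
  have X_near: "dist (X k t) (X n t) \<le> d"
    if "t \<in> {0..<M}" "n \<le> k"
      "\<And>k j. k \<ge> n \<Longrightarrow> 0 < g k j \<Longrightarrow> dist (z k j) (z n (j div 2 ^ (k - n))) \<le> d" for t n k d
    using that(3)[OF that(2) g_pos[OF that(1)]] that(2) by (simp add: X_def J_def branch_div)
  \<comment> \<open>By \<open>near\<close>, the points attached along the branch of \<open>t\<close>
    form a Cauchy sequence, and completeness puts their limit into \<open>K\<close>.\<close>
  define Y where "Y t = lim (\<lambda>n. X n t)" for t
  have Y: "(\<lambda>n. X n t) \<longlonglongrightarrow> Y t" "Y t \<in> K" if t: "t \<in> {0..<M}" for t
  proof -
    have "Cauchy (\<lambda>n. X n t)"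
    proof (rule metric_CauchyI)
      fix e :: real assume e: "0 < e"
      from near[of "e / 3"] e obtain n where
        n: "\<And>k j. k \<ge> n \<Longrightarrow> 0 < g k j \<Longrightarrow> dist (z k j) (z n (j div 2 ^ (k - n))) \<le> e / 3" by auto
      have "dist (X k t) (X m t) < e" if "k \<ge> n" "m \<ge> n" for k m
        using X_near[OF t that(1) n] X_near[OF t that(2) n] e
          dist_triangle2[of "X k t" "X m t" "X n t"] by linarith
      then show "\<exists>N. \<forall>k\<ge>N. \<forall>m\<ge>N. dist (X k t) (X m t) < e" by blast
    qed
    then obtain l where "l \<in> K" "(\<lambda>n. X n t) \<longlonglongrightarrow> l"
      using completeE[OF compact_imp_complete[OF K]] XK[OF t] by metis
    then show "(\<lambda>n. X n t) \<longlonglongrightarrow> Y t" "Y t \<in> K"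
      by (simp_all add: Y_def limI)
  qed
  have J_meas: "J n \<in> L \<rightarrow>\<^sub>M count_space UNIV" for n
    unfolding L_def J_def by (intro measurable_restrict_space1) simp
  have X_meas: "X n \<in> borel_measurable L" for n
    unfolding X_def by (rule measurable_compose[OF J_meas]) simp
  have "Y \<in> borel_measurable L"
    by (rule borel_measurable_LIMSEQ_metric[where f = X, OF X_meas]) (simp add: spL Y)
  then have Y_meas: "Y \<in> L \<rightarrow>\<^sub>M restrict_space borel K"
    by (intro measurable_restrict_space2) (auto simp: spL Y)
  define N where "N = distr L (restrict_space borel K) Y"
  show thesis
  proof (rule that[of N])
    show "finite_measure N"
      unfolding N_def by (rule L.finite_measure_distr[OF Y_meas])
    show "sets N = borel_sets K" by (simp add: N_def)
    fix n d e and f :: "'a \<Rightarrow> real"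
    assume f: "continuous_on K f"
      and d: "\<And>k j. k \<ge> n \<Longrightarrow> 0 < g k j \<Longrightarrow> dist (z k j) (z n (j div 2 ^ (k - n))) \<le> d"
      and e: "\<And>x y. x \<in> K \<Longrightarrow> y \<in> K \<Longrightarrow> dist x y \<le> d \<Longrightarrow> \<bar>f x - f y\<bar> \<le> e"
    have fm: "f \<in> borel_measurable (restrict_space borel K)"
      by (rule borel_measurable_continuous_on_restrict[OF f])
    obtain b where b: "\<And>x. x \<in> K \<Longrightarrow> \<bar>f x\<bar> \<le> b"
      using compact_imp_bounded[OF compact_continuous_image[OF f K]]
      by (auto simp: bounded_iff)
    have fN: "(\<integral>x. f x \<partial>N) = (\<integral>t. f (Y t) \<partial>L)"
      unfolding N_def by (rule integral_distr[OF Y_meas fm])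
    have iY: "integrable L (\<lambda>t. f (Y t))"
      by (rule L.integrable_const_bound[of _ b])
        (use b Y measurable_compose[OF Y_meas fm] in \<open>auto simp: spL\<close>)
    have "X n \<in> L \<rightarrow>\<^sub>M restrict_space borel K"
      using X_meas by (intro measurable_restrict_space2) (auto simp: spL XK)
    from measurable_compose[OF this fm] have iX: "integrable L (\<lambda>t. f (X n t))"
      by (intro L.integrable_const_bound[of _ b]) (use b XK in \<open>auto simp: spL\<close>)
    have YX: "\<bar>f (Y t) - f (X n t)\<bar> \<le> e" if t: "t \<in> {0..<M}" for t
    proof (rule e[OF Y(2)[OF t] XK[OF t]])
      have "(\<lambda>k. dist (X k t) (X n t)) \<longlonglongrightarrow> dist (Y t) (X n t)"
        by (intro tendsto_intros Y t)
      then show "dist (Y t) (X n t) \<le> d"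
        by (rule LIMSEQ_le_const2) (use X_near[OF t _ d] in blast)
    qed
    have "\<bar>(\<integral>t. f (Y t) - f (X n t) \<partial>L)\<bar> \<le> (\<integral>t. \<bar>f (Y t) - f (X n t)\<bar> \<partial>L)"
      by (rule integral_abs_bound)
    also have "\<dots> \<le> (\<integral>t. e \<partial>L)"
      by (rule integral_mono) (use iX iY YX in \<open>auto simp: spL\<close>)
    also have "\<dots> = e * M" by (simp add: measL)
    finally have 1: "\<bar>(\<integral>t. f (Y t) \<partial>L) - (\<integral>t. f (X n t) \<partial>L)\<bar> \<le> e * M"
      using iX iY by simp
    have ind: "integrable L (indicator {F n j..<F n (Suc j)} :: real \<Rightarrow> real)"
      "(\<integral>t. indicator {F n j..<F n (Suc j)} t \<partial>L) = g n j" if j: "j < 2 ^ n" for j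
    proof -
      have sub: "{F n j..<F n (Suc j)} \<subseteq> {0..<M}"
        using F_mono[of 0 j n] F_mono[of "Suc j" "2 ^ n" n] j F_top[of n] by (auto simp: M_def F_def)
      then have S: "{F n j..<F n (Suc j)} \<in> sets L"
        by (auto simp: L_def sets_restrict_space_iff)
      then show "integrable L (indicator {F n j..<F n (Suc j)} :: real \<Rightarrow> real)"
        by (intro integrable_real_indicator) (auto simp: L.emeasure_eq_measure)
      have "measure L {F n j..<F n (Suc j)} = measure lborel {F n j..<F n (Suc j)}"
        unfolding L_def using sub by (intro measure_restrict_space) auto
      also have "\<dots> = g n j"
        using nonneg[of n j] by (simp add: F_Suc)
      finally show "(\<integral>t. indicator {F n j..<F n (Suc j)} t \<partial>L) = g n j"
        using sets.sets_into_space[OF S] by (simp add: Int_absorb2)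
    qed
    \<comment> \<open>\<open>X n\<close> is constant on each interval of level \<open>n\<close>, and
      interval \<open>j\<close> has length \<open>g n j\<close>; so the integral of this step
      function is the discrete sum.\<close>
    have "(\<integral>t. f (X n t) \<partial>L) = (\<integral>t. (\<Sum>j<2 ^ n. f (z n j) * indicator {F n j..<F n (Suc j)} t) \<partial>L)"
    proof (rule Bochner_Integration.integral_cong)
      fix t assume "t \<in> space L"
      then have t: "t \<in> {0..<M}" by (simp add: spL)
      have "(\<Sum>j<2 ^ n. f (z n j) * indicator {F n j..<F n (Suc j)} t) =
            (\<Sum>j\<in>{J n t}. f (z n j) * indicator {F n j..<F n (Suc j)} t)"
        by (rule sum.mono_neutral_right)
          (use J_unique[OF t] in \<open>auto simp: J_def branch_less indicator_def\<close>)
      also have "\<dots> = f (X n t)"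
        using J_in[OF t, of n] by (simp add: X_def)
      finally show "f (X n t) = (\<Sum>j<2 ^ n. f (z n j) * indicator {F n j..<F n (Suc j)} t)" ..
    qed simp
    also have "\<dots> = (\<Sum>j<2 ^ n. f (z n j) * (\<integral>t. indicator {F n j..<F n (Suc j)} t \<partial>L))"
      by (subst Bochner_Integration.integral_sum) (use ind in auto)
    also have "\<dots> = (\<Sum>j<2 ^ n. g n j * f (z n j))"
      by (rule sum.cong) (use ind in auto)
    finally show "\<bar>(\<integral>x. f x \<partial>N) - (\<Sum>j<2 ^ n. g n j * f (z n j))\<bar> \<le> e * g 0 0"
      using 1 by (simp add: fN M_def)
  qed
qed

section \<open>Trees of partitions of unity and greedy splitting\<close>

text \<open>For every \<open>k\<close> take a finite net of mesh \<open>1 / Suc k\<close>. Around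
  each centre, \<open>r k i\<close> is a bump equal to 1 up to distance \<open>1 / Suc k\<close> and
  equal to 0 from distance \<open>2 / Suc k\<close> on. That \<open>N\<close> depends on
  \<open>e\<close> alone will make the supports in the tree shrink uniformly.\<close>

lemma separating_sequence:
  fixes K :: "'a::metric_space set"
  assumes "compact K"
  obtains q :: "nat \<Rightarrow> 'a \<Rightarrow> real" where
    "\<And>n. continuous_on K (q n)" "\<And>n x. 0 \<le> q n x" "\<And>n x. q n x \<le> 1"
    "\<And>e. 0 < e \<Longrightarrow> \<exists>N. \<forall>x\<in>K. \<forall>y\<in>K. e \<le> dist x y \<longrightarrow> (\<exists>n<N. q n x = 0 \<and> q n y = 1)"
proof -
  have "\<exists>xs. K \<subseteq> (\<Union>a\<in>set xs. ball a (1 / real (Suc k)))" for k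
  proof -
    obtain A where "finite A" "K \<subseteq> (\<Union>a\<in>A. ball a (1 / real (Suc k)))"
      using compact_imp_seq_compact[OF assms, THEN seq_compact_imp_totally_bounded]
      by (metis zero_less_divide_1_iff of_nat_0_less_iff zero_less_Suc)
    then show ?thesis using finite_list by metis
  qed
  then obtain xs where xs: "\<And>k. K \<subseteq> (\<Union>a\<in>set (xs k). ball a (1 / real (Suc k)))"
    by metis
  define r where "r k i x = max 0 (min 1 (2 - real (Suc k) * dist x (xs k ! i)))" for k i x
  \<comment> \<open>The enumeration also meets indices \<open>i\<close> beyond the length of
    \<open>xs k\<close>, where the centre is some unspecified point. Continuity and the bounds hold
    for any centre, and separation uses valid indices.\<close>
  define q where "q n = r (fst (prod_decode n)) (snd (prod_decode n))" for n
  show thesis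
  proof (rule that[of q])
    show "continuous_on K (q n)" for n
      unfolding q_def r_def by (intro continuous_intros)
    show "0 \<le> q n x" "q n x \<le> 1" for n x
      by (simp_all add: q_def r_def)
    fix e :: real assume e: "0 < e"
    \<comment> \<open>Since \<open>e > 3 / Suc k\<close>, a centre within \<open>1 / Suc k\<close>
      of \<open>y\<close> is farther than \<open>2 / Suc k\<close> from \<open>x\<close>.\<close>
    obtain k where k: "3 / e < real (Suc k)"
      by (meson less_SucI of_nat_less_iff order.strict_trans reals_Archimedean2 lessI)
    obtain N where N: "\<And>i. i < length (xs k) \<Longrightarrow> prod_encode (k, i) < N"
      using finite_nat_set_iff_bounded[of "(\<lambda>i. prod_encode (k, i)) ` {..<length (xs k)}"] by auto
    have "\<exists>n<N. q n x = 0 \<and> q n y = 1" if xy: "x \<in> K" "y \<in> K" "e \<le> dist x y" for x y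
    proof -
      from xs[of k] xy obtain i where i: "i < length (xs k)" "dist (xs k ! i) y < 1 / real (Suc k)"
        by (metis (no_types, lifting) UN_E in_set_conv_nth mem_ball subsetD)
      let ?a = "xs k ! i"
      have y: "real (Suc k) * dist y ?a < 1"
        using i by (simp add: dist_commute field_simps del: of_nat_Suc)
      have "3 < real (Suc k) * e" using k e by (simp add: field_simps del: of_nat_Suc)
      also have "\<dots> \<le> real (Suc k) * dist x y" using xy by simp
      also have "\<dots> \<le> real (Suc k) * (dist x ?a + dist y ?a)"
        by (intro mult_left_mono dist_triangle2) simp
      finally have "2 \<le> real (Suc k) * dist x ?a"
        using y by (simp add: distrib_left del: of_nat_Suc)
      with y have "r k i x = 0" "r k i y = 1"
        by (simp_all add: r_def del: of_nat_Suc)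
      then show ?thesis
        using N[OF i(1)] by (intro exI[of _ "prod_encode (k, i)"]) (simp add: q_def)
    qed
    then show "\<exists>N. \<forall>x\<in>K. \<forall>y\<in>K. e \<le> dist x y \<longrightarrow> (\<exists>n<N. q n x = 0 \<and> q n y = 1)"
      by blast
  qed
qed

text \<open>All nodes of level \<open>n\<close> are split by the same \<open>q n\<close>. Indices
  from \<open>2 ^ n\<close> on lie outside the tree; giving them values as well avoids side
  conditions on \<open>j\<close>, and the sums over a level stop before them.\<close>

primrec weight :: "(nat \<Rightarrow> 'a \<Rightarrow> real) \<Rightarrow> nat \<Rightarrow> nat \<Rightarrow> 'a \<Rightarrow> real" where
  "weight q 0 j x = 1"
| "weight q (Suc n) j x = weight q n (j div 2) x * (if even j then q n x else 1 - q n x)"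

lemma weight_split: "weight q (Suc n) (2 * j) x + weight q (Suc n) (Suc (2 * j)) x = weight q n j x"
  by (simp add: algebra_simps)

lemma sum_weight: "(\<Sum>j<2 ^ n. weight q n j x) = 1"
  by (induction n) (simp_all add: sum_double weight_split del: weight.simps(2))

text \<open>\<open>c\<close> holds the capacities of the nodes. Both children evaluate the same
  \<open>m\<close>, the share of the left one, because \<open>2 * (j div 2)\<close> is the left
  sibling of an odd \<open>j\<close>.\<close>

primrec greedy :: "(nat \<Rightarrow> nat \<Rightarrow> real) \<Rightarrow> nat \<Rightarrow> nat \<Rightarrow> real" where
  "greedy c 0 j = c 0 j"
| "greedy c (Suc n) j =
     (let m = min (greedy c n (j div 2)) (c (Suc n) (2 * (j div 2)))
      in if even j then m else greedy c n (j div 2) - m)"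

lemma greedy_split: "greedy c (Suc n) (2 * j) + greedy c (Suc n) (Suc (2 * j)) = greedy c n j"
  by (simp add: Let_def)

lemma greedy_nonneg:
  assumes "\<And>n j. 0 \<le> c n j"
  shows "0 \<le> greedy c n j"
  by (induction n arbitrary: j) (simp_all add: Let_def assms)

text \<open>Only right children need an argument. If the left child takes the whole mass, 0 remains;
  otherwise the left child is filled to its capacity, and the rest fits into the right child because
  the capacity of the parent is at most the sum of those of its children.\<close>

lemma greedy_le:
  assumes "\<And>n j. 0 \<le> c n j"
    and sub: "\<And>n j. c n j \<le> c (Suc n) (2 * j) + c (Suc n) (Suc (2 * j))"
  shows "greedy c n j \<le> c n j"
proof (induction n arbitrary: j)
  case (Suc n)
  show ?case
  proof (cases "even j")
    case True
    then show ?thesis by (simp add: Let_def)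
  next
    case False
    then have "j = Suc (2 * (j div 2))" by presburger
    then have "c n (j div 2) \<le> c (Suc n) (2 * (j div 2)) + c (Suc n) j"
      using sub[of n "j div 2"] by simp
    with False Suc[of "j div 2"] assms(1)[of "Suc n" j] show ?thesis
      by (simp add: Let_def min_def)
  qed
qed simp

text \<open>The error is controlled relative to \<open>b\<close>, which may be unbounded on the
  whole space. Being continuous, \<open>b\<close> is bounded near each point, so the approximation
  is locally uniform.\<close>

lemma continuous_map_locally_uniform_limit:
  fixes f b :: "'a \<Rightarrow> real"
  assumes b: "continuous_map X euclideanreal b"
    and approx: "\<And>e. 0 < e \<Longrightarrow> \<exists>s. continuous_map X euclideanreal s \<and>
      (\<forall>x\<in>topspace X. \<bar>f x - s x\<bar> \<le> e * b x)"
  shows "continuous_map X euclideanreal f"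
  unfolding continuous_map_atin limitin_canonical_iff
proof (intro ballI tendstoI)
  fix x and e :: real assume x: "x \<in> topspace X" and e: "0 < e"
  \<comment> \<open>Two approximation errors of at most \<open>e / 4\<close> and a variation of
    \<open>s\<close> below \<open>e / 2\<close> add up to less than \<open>e\<close>; the summand 1
    keeps the denominator positive.\<close>
  define d where "d = e / (4 * (\<bar>b x\<bar> + 1))"
  have d: "0 < d" using e by (simp add: d_def add_nonneg_pos)
  from approx[OF d] obtain s where s: "continuous_map X euclideanreal s"
    and fs: "\<And>y. y \<in> topspace X \<Longrightarrow> \<bar>f y - s y\<bar> \<le> d * b y" by blast
  have top: "\<forall>\<^sub>F y in atin X x. y \<in> topspace X"
    unfolding eventually_atin using x by blast
  have "(b \<longlongrightarrow> b x) (atin X x)" "(s \<longlongrightarrow> s x) (atin X x)"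
    using b s x by (simp_all add: continuous_map_atin)
  then have "\<forall>\<^sub>F y in atin X x. b y < \<bar>b x\<bar> + 1" "\<forall>\<^sub>F y in atin X x. dist (s y) (s x) < e / 2"
    using e by (auto intro: order_tendstoD simp del: less_divide_eq_numeral1 dest: tendstoD[of _ _ _ "e / 2"])
  with top show "\<forall>\<^sub>F y in atin X x. dist (f y) (f x) < e"
  proof eventually_elim
    case (elim y)
    have "d * b y \<le> d * (\<bar>b x\<bar> + 1)" "d * b x \<le> d * (\<bar>b x\<bar> + 1)"
      using elim d by (auto intro!: mult_left_mono)
    moreover have "d * (\<bar>b x\<bar> + 1) = e / 4"
      by (simp add: d_def field_simps add_nonneg_eq_0_iff)
    ultimately have "\<bar>f y - s y\<bar> \<le> e / 4" "\<bar>f x - s x\<bar> \<le> e / 4"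
      using fs[of y] fs[OF x] elim by linarith+
    with elim(3) show ?case unfolding dist_real_def by linarith
  qed
qed

section \<open>Supports of the weights\<close>

lemma weight_nonneg:
  assumes "\<And>n x. 0 \<le> q n x" "\<And>n x. q n x \<le> 1"
  shows "0 \<le> weight q n j x"
  by (induction n arbitrary: j) (simp_all add: assms)

lemma weight_Suc_posD:
  assumes "\<And>n x. 0 \<le> q n x" "\<And>n x. q n x \<le> 1" "0 < weight q (Suc n) j x"
  shows "0 < weight q n (j div 2) x" "(if even j then q n x else 1 - q n x) \<noteq> 0"
  using assms(3) weight_nonneg[of q n "j div 2" x, OF assms(1,2)]
  by (auto simp: zero_less_mult_iff split: if_splits)

text \<open>A weight is a product of nonnegative factors along a branch, so supports are
  nested.\<close>

lemma weight_ancestor: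
  assumes q: "\<And>n x. 0 \<le> q n x" "\<And>n x. q n x \<le> 1"
  shows "n \<le> k \<Longrightarrow> 0 < weight q k j x \<Longrightarrow> 0 < weight q n (j div 2 ^ (k - n)) x"
proof (induction k arbitrary: j)
  case (Suc k)
  show ?case
  proof (cases "n \<le> k")
    case True
    then have "j div 2 ^ (Suc k - n) = j div 2 div 2 ^ (k - n)"
      by (simp add: Suc_diff_le div_mult2_eq)
    with Suc.IH[OF True weight_Suc_posD(1)[where q = q, OF q Suc.prems(2)]] show ?thesis by simp
  next
    case False
    with Suc.prems show ?thesis by (simp add: le_Suc_eq del: weight.simps)
  qed
qed simp

text \<open>Every weight beyond level \<open>n\<close> contains the factor \<open>q n\<close>, which
  vanishes at \<open>x\<close>, or \<open>1 - q n\<close>, which vanishes at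
  \<open>y\<close>.\<close>

lemma weight_separated:
  assumes q: "\<And>n x. 0 \<le> q n x" "\<And>n x. q n x \<le> 1"
    and "q n x = 0" "q n y = 1"
  shows "n < N \<Longrightarrow> 0 < weight q N j x \<Longrightarrow> 0 < weight q N j y \<Longrightarrow> False"
proof (induction N arbitrary: j)
  case (Suc N)
  note wx = weight_Suc_posD[where q = q, OF q Suc.prems(2)] and wy = weight_Suc_posD[where q = q, OF q Suc.prems(3)]
  show ?case
  proof (cases "n = N")
    case True
    with wx(2) wy(2) assms(3,4) show ?thesis by (simp split: if_splits)
  next
    case False
    with Suc.prems Suc.IH[OF _ wx(1) wy(1)] show ?thesis by simp
  qed
qed simp

section \<open>Domination and regularity\<close>

lemma integrable_continuous_on_compact:
  fixes f :: "'a::metric_space \<Rightarrow> real"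
  assumes K: "compact K" and N: "finite_measure N" "sets N = borel_sets K" and f: "continuous_on K f"
  shows "integrable N f"
proof -
  have sp: "space N = K" by (rule sets_eq_borel_sets_imp_space[OF N(2)])
  obtain b where b: "\<And>x. x \<in> K \<Longrightarrow> norm (f x) \<le> b"
    using compact_imp_bounded[OF compact_continuous_image[OF f K]] by (auto simp: bounded_iff)
  have "f \<in> borel_measurable N"
    using borel_measurable_continuous_on_restrict[OF f] measurable_cong_sets[OF N(2) refl] by blast
  then show ?thesis
    using b by (intro finite_measure.integrable_const_bound[OF N(1), of _ b]) (auto simp: sp)
qed

lemma compact_in_borel_sets:
  fixes K :: "'a::metric_space set"
  assumes "compact K" "compact C" "C \<subseteq> K"
  shows "C \<in> borel_sets K"
  using assms by (auto simp: sets_restrict_space_iff compact_imp_closed)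

lemma openin_in_borel_sets:
  "openin (top_of_set K) U \<Longrightarrow> U \<in> borel_sets K"
  by (auto simp: openin_open sets_restrict_space)

context
  fixes K :: "'a::metric_space set" and \<mu> :: "'a set \<Rightarrow> real" and P Q :: "'a measure"
  assumes K: "compact K" and \<mu>: "\<mu> \<in> regular_measures K"
  defines "P \<equiv> to_measure K (positive_part K \<mu>)" and "Q \<equiv> to_measure K (negative_part K \<mu>)"
begin

lemma regular_measures_signed: "signed_borel_measure K \<mu>"
  using \<mu> by (simp add: regular_measures_def)

lemma jordan:
  "finite_measure P" "sets P = borel_sets K" "measure P = positive_part K \<mu>" "space P = K"
  "finite_measure Q" "sets Q = borel_sets K" "measure Q = negative_part K \<mu>" "space Q = K"
  using positive_part_is_measure[OF regular_measures_signed]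
    positive_part_is_measure[OF signed_borel_measure_uminus[OF regular_measures_signed]]
  unfolding P_def Q_def negative_part_def by (simp_all add: sets_eq_borel_sets_imp_space)

lemma signed_integral_jordan: "signed_integral K \<mu> f = (\<integral>x. f x \<partial>P) - (\<integral>x. f x \<partial>Q)"
  by (simp add: signed_integral_def P_def Q_def)

lemma integrable_jordan: "continuous_on K f \<Longrightarrow> integrable P f" "continuous_on K f \<Longrightarrow> integrable Q f"
  for f :: "'a \<Rightarrow> real"
  using integrable_continuous_on_compact[OF K] jordan by blast+

lemma signed_integral_add:
  "continuous_on K f \<Longrightarrow> continuous_on K h \<Longrightarrow>
    signed_integral K \<mu> (\<lambda>x. f x + h x) = signed_integral K \<mu> f + signed_integral K \<mu> h"
  by (simp add: signed_integral_jordan integrable_jordan)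

lemma signed_integral_const_1: "signed_integral K \<mu> (\<lambda>_. 1) = \<mu> K"
  using negative_part_eq[OF regular_measures_signed borel_sets_self] by (simp add: signed_integral_jordan jordan)

lemma signed_integral_zero:
  assumes "\<And>x. x \<in> K \<Longrightarrow> f x = 0"
  shows "signed_integral K \<mu> f = 0"
proof -
  have "(\<integral>x. f x \<partial>P) = (\<integral>x. 0 \<partial>P)" "(\<integral>x. f x \<partial>Q) = (\<integral>x. 0 \<partial>Q)"
    by (rule Bochner_Integration.integral_cong; simp add: jordan assms)+
  then show ?thesis by (simp add: signed_integral_jordan)
qed

lemma signed_integral_le:
  assumes "\<And>x. x \<in> K \<Longrightarrow> 0 \<le> f x"
  shows "signed_integral K \<mu> f \<le> (\<integral>x. f x \<partial>P)"
proof -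
  have "0 \<le> (\<integral>x. f x \<partial>Q)"
    by (rule integral_nonneg_AE) (use assms in \<open>auto simp: jordan\<close>)
  then show ?thesis by (simp add: signed_integral_jordan)
qed

lemma total_variation_jordan: "total_variation K \<mu> A = measure P A + measure Q A"
  by (simp add: total_variation_def jordan)

text \<open>Regularity speaks of the total variation, the sum of \<open>P\<close> and
  \<open>Q\<close>. As \<open>Q\<close> is monotone, an open set that is nearly optimal for the sum
  is nearly optimal for \<open>P\<close> alone.\<close>

lemma outer_approx:
  assumes "A \<in> borel_sets K" "0 < e"
  obtains U where "openin (top_of_set K) U" "A \<subseteq> U" "measure P U - measure P A < e"
proof -
  let ?S = "{total_variation K \<mu> U | U. openin (top_of_set K) U \<and> A \<subseteq> U}"
  have "total_variation K \<mu> A = Inf ?S"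
    using \<mu> assms(1) unfolding regular_measures_def regular_signed_def by blast
  moreover have "?S \<noteq> {}"
    using borel_sets_subset[OF assms(1)] by auto
  ultimately obtain U where U: "openin (top_of_set K) U" "A \<subseteq> U"
    "total_variation K \<mu> U < total_variation K \<mu> A + e"
    using cInf_lessD[of ?S "total_variation K \<mu> A + e"] assms(2) by auto
  have "measure Q A \<le> measure Q U"
    using finite_measure.finite_measure_mono[OF jordan(5) U(2)] openin_in_borel_sets[OF U(1)]
    by (simp add: jordan)
  with U that show thesis by (simp add: total_variation_jordan)
qed

text \<open>Dual to \<open>outer_approx\<close>, with compact sets from inside.\<close>

lemma inner_approx:
  assumes "A \<in> borel_sets K" "0 < e"
  obtains C where "compact C" "C \<subseteq> A" "measure P A - measure P C < e"
proof -
  let ?S = "{total_variation K \<mu> C | C. compact C \<and> C \<subseteq> A}"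
  have "total_variation K \<mu> A = Sup ?S"
    using \<mu> assms(1) unfolding regular_measures_def regular_signed_def by blast
  moreover have "?S \<noteq> {}" by auto
  ultimately obtain C where C: "compact C" "C \<subseteq> A"
    "total_variation K \<mu> A - e < total_variation K \<mu> C"
    using less_cSupD[of ?S "total_variation K \<mu> A - e"] assms(2) by auto
  have "measure Q C \<le> measure Q A"
    using finite_measure.finite_measure_mono[OF jordan(5) C(2)] assms(1) by (simp add: jordan)
  with C that show thesis by (simp add: total_variation_jordan)
qed

text \<open>The indicator of an open set is a pointwise limit of continuous functions with values in
  [0, 1], so dominated convergence settles open sets. Outer approximation for \<open>P\<close> and
  monotonicity of \<open>N\<close> carry the inequality to all Borel sets.\<close>

lemma dominated_if_integrals_dominated:
  assumes N: "finite_measure N" "sets N = borel_sets K"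
    and le: "\<And>f :: 'a \<Rightarrow> real. continuous_on K f \<Longrightarrow> (\<And>x. x \<in> K \<Longrightarrow> 0 \<le> f x) \<Longrightarrow> (\<integral>x. f x \<partial>N) \<le> (\<integral>x. f x \<partial>P)"
    and A: "A \<in> borel_sets K"
  shows "measure N A \<le> measure P A"
proof -
  have spN: "space N = K" by (rule sets_eq_borel_sets_imp_space[OF N(2)])
  interpret N: finite_measure N by fact
  interpret P: finite_measure P by (rule jordan)
  have op: "measure N U \<le> measure P U" if U: "openin (top_of_set K) U" for U
  \<comment> \<open>The distance to the empty set is 0 by convention, so the functions
    \<open>f n\<close> below would vanish for \<open>U = K\<close>; the constant 1 serves
    instead.\<close>
  proof (cases "K - U = {}")
    case True
    with openin_imp_subset[OF U] have "U = K" by blast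
    then show ?thesis using le[of "\<lambda>_. 1"] by (simp add: spN jordan)
  next
    case False
    define f where "f n x = min 1 (real n * infdist x (K - U))" for n x
    have cl: "closed (K - U)"
      using U K by (metis closedin_closed_trans closedin_diff closedin_topspace compact_imp_closed
        topspace_euclidean_subtopology)
    have f: "continuous_on K (f n)" "0 \<le> f n x" "f n x \<le> 1" for n x
      unfolding f_def by (auto intro!: continuous_intros mult_nonneg_nonneg infdist_nonneg)
    have lim: "(\<lambda>n. f n x) \<longlonglongrightarrow> indicator U x" if x: "x \<in> K" for x
    proof (cases "x \<in> U")
      case True
      then have "0 < infdist x (K - U)"
        by (intro infdist_pos_not_in_closed cl False) simp
      then obtain m where "1 < real m * infdist x (K - U)"
        using reals_Archimedean3 by blast
      then have "1 \<le> real n * infdist x (K - U)" if "n \<ge> m" for n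
        using mult_right_mono[of "real m" "real n" "infdist x (K - U)"] that infdist_nonneg[of x "K - U"]
        by simp
      then have "\<forall>\<^sub>F n in sequentially. f n x = indicator U x"
        using True unfolding f_def by (intro eventually_sequentiallyI[of m]) simp
      then show ?thesis by (rule tendsto_eventually)
    next
      case False
      with x show ?thesis by (simp add: f_def)
    qed
    have conv: "(\<lambda>n. \<integral>x. f n x \<partial>R) \<longlonglongrightarrow> measure R U"
      if R: "finite_measure R" "sets R = borel_sets K" for R
    proof -
      have sp: "space R = K" by (rule sets_eq_borel_sets_imp_space[OF R(2)])
      interpret R: finite_measure R by fact
      have US: "U \<in> sets R" using openin_in_borel_sets[OF U] R(2) by simp
      have "(\<lambda>n. \<integral>x. f n x \<partial>R) \<longlonglongrightarrow> (\<integral>x. indicator U x \<partial>R)"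
      proof (rule integral_dominated_convergence[where w = "\<lambda>_. 1"])
        show "f n \<in> borel_measurable R" for n
          using integrable_continuous_on_compact[OF K R f(1)] by (rule borel_measurable_integrable)
        show "AE x in R. (\<lambda>n. f n x) \<longlonglongrightarrow> indicator U x"
          using lim by (auto simp: sp)
      qed (use US f in \<open>auto simp: abs_le_iff\<close>)
      then show ?thesis using sets.sets_into_space[OF US] by (simp add: Int_absorb2)
    qed
    show ?thesis
      by (rule LIMSEQ_le[OF conv[OF N] conv[OF jordan(1,2)]]) (use le f in blast)
  qed
  show ?thesis
  proof (rule field_le_epsilon)
    fix e :: real assume "0 < e"
    with outer_approx[OF A] obtain U where
      U: "openin (top_of_set K) U" "A \<subseteq> U" "measure P U - measure P A < e" by blast
    have "measure N A \<le> measure N U"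
      using U openin_in_borel_sets[OF U(1)] N(2) by (intro N.finite_measure_mono) auto
    with op[OF U(1)] U(3) show "measure N A \<le> measure P A + e" by linarith
  qed
qed

text \<open>Domination applied to \<open>A - B\<close> shows that \<open>N\<close> loses no more
  than \<open>P\<close> when \<open>A\<close> is replaced by a subset \<open>B\<close>. Compact and
  open approximations for \<open>P\<close> are therefore at least as good for
  \<open>N\<close>.\<close>

lemma regular_if_dominated:
  assumes N: "finite_measure N" "sets N = borel_sets K"
    and le: "\<And>A. A \<in> borel_sets K \<Longrightarrow> measure N A \<le> measure P A"
  shows "measure N \<in> regular_measures K"
proof -
  have spN: "space N = K" by (rule sets_eq_borel_sets_imp_space[OF N(2)])
  interpret N: finite_measure N by fact
  interpret P: finite_measure P by (rule jordan)
  have tv: "total_variation K (measure N) = measure N"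
    by (rule ext) (simp add: total_variation_def positive_part_measure[OF N] negative_part_measure[OF N])
  have diff: "measure N A - measure N B \<le> measure P A - measure P B"
    if "A \<in> borel_sets K" "B \<in> borel_sets K" "B \<subseteq> A" for A B
    using le[of "A - B"] that
    by (simp add: sets.Diff N.finite_measure_Diff P.finite_measure_Diff N(2) jordan(2))
  have "measure N A = Sup {measure N C | C. compact C \<and> C \<subseteq> A}" (is "_ = Sup ?S")
    if A: "A \<in> borel_sets K" for A
  proof (rule antisym)
    have m: "measure N C \<le> measure N A" if "C \<subseteq> A" for C
      using that A N(2) by (intro N.finite_measure_mono) auto
    then have bdd: "bdd_above ?S" by (auto intro!: bdd_aboveI[of _ "measure N A"])
    show "Sup ?S \<le> measure N A" by (rule cSup_least) (use m in auto)
    show "measure N A \<le> Sup ?S"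
    proof (rule field_le_epsilon)
      fix e :: real assume "0 < e"
      with inner_approx[OF A] obtain C where
        C: "compact C" "C \<subseteq> A" "measure P A - measure P C < e" by blast
      have "C \<in> borel_sets K"
        using compact_in_borel_sets[OF K C(1)] C(2) borel_sets_subset[OF A] by blast
      from diff[OF A this C(2)] C(3) have "measure N A < measure N C + e" by linarith
      moreover have "measure N C \<le> Sup ?S" by (rule cSup_upper[OF _ bdd]) (use C in auto)
      ultimately show "measure N A \<le> Sup ?S + e" by linarith
    qed
  qed
  moreover have "measure N A = Inf {measure N U | U. openin (top_of_set K) U \<and> A \<subseteq> U}" (is "_ = Inf ?S")
    if A: "A \<in> borel_sets K" for A
  proof (rule antisym)
    have m: "measure N A \<le> measure N U" if "openin (top_of_set K) U" "A \<subseteq> U" for U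
      using that openin_in_borel_sets[OF that(1)] N(2) by (intro N.finite_measure_mono) auto
    then have bdd: "bdd_below ?S" by (auto intro!: bdd_belowI[of _ "measure N A"])
    have "?S \<noteq> {}" using borel_sets_subset[OF A] by auto
    then show "measure N A \<le> Inf ?S" by (rule cInf_greatest) (use m in auto)
    show "Inf ?S \<le> measure N A"
    proof (rule field_le_epsilon)
      fix e :: real assume "0 < e"
      with outer_approx[OF A] obtain U where
        U: "openin (top_of_set K) U" "A \<subseteq> U" "measure P U - measure P A < e" by blast
      from diff[OF openin_in_borel_sets[OF U(1)] A U(2)] U(3)
      have "measure N U < measure N A + e" by linarith
      moreover have "Inf ?S \<le> measure N U" by (rule cInf_lower[OF _ bdd]) (use U in auto)
      ultimately show "Inf ?S \<le> measure N A + e" by linarith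
    qed
  qed
  ultimately show ?thesis
    by (simp add: regular_measures_def regular_signed_def tv signed_borel_measure_measure[OF N])
qed

end

section \<open>The compensation\<close>

definition node_mass where
  "node_mass K q \<mu> n j = max 0 (signed_integral K \<mu> (weight q n j))"

text \<open>The choice is arbitrary when the support misses \<open>K\<close>; by
  \<open>greedy_pos_support\<close> such nodes never carry mass.\<close>

definition node_point where
  "node_point K q n j = (SOME x. x \<in> K \<and> 0 < weight q n j x)"

definition narrow :: "'a::metric_space set \<Rightarrow> (nat \<Rightarrow> 'a \<Rightarrow> real) \<Rightarrow> real \<Rightarrow> nat \<Rightarrow> bool" where
  "narrow K q d n \<longleftrightarrow> (\<forall>j. \<forall>x\<in>K. \<forall>y\<in>K. 0 < weight q n j x \<longrightarrow> 0 < weight q n j y \<longrightarrow> dist x y \<le> d)"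

lemma node_point:
  assumes "x \<in> K" "0 < weight q n j x"
  shows "node_point K q n j \<in> K" "0 < weight q n j (node_point K q n j)"
  unfolding node_point_def using someI[of "\<lambda>x. x \<in> K \<and> 0 < weight q n j x" x] assms by auto

lemma le_if_le_add_mult:
  fixes a b C :: real
  assumes "\<And>e. 0 < e \<Longrightarrow> a \<le> b + e * C" "0 \<le> C"
  shows "a \<le> b"
proof (rule field_le_epsilon)
  fix e :: real assume e: "0 < e"
  have "a \<le> b + e / (C + 1) * C" by (rule assms(1)) (use assms(2) e in simp)
  also have "e / (C + 1) * C \<le> e" using assms(2) e by (simp add: field_simps)
  finally show "a \<le> b + e" by simp
qed

section \<open>Continuity with respect to the weak* topology\<close>

lemma topspace_weak_star: "topspace (weak_star K) = regular_measures K"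
  by (auto simp: weak_star_def topspace_pullback_topology)

lemma continuous_signed_integral:
  assumes "continuous_on K f"
  shows "continuous_map (weak_star K) euclideanreal (\<lambda>\<mu>. signed_integral K \<mu> f)"
proof -
  let ?C = "{f. continuous_on K f}"
  have "continuous_map (weak_star K) euclideanreal
    ((\<lambda>x. x f) \<circ> (\<lambda>\<mu>. \<lambda>f\<in>?C. signed_integral K \<mu> f))"
    unfolding weak_star_def
    by (rule continuous_map_pullback, rule continuous_map_product_projection) (simp add: assms)
  then show ?thesis using assms by (simp add: o_def)
qed

text \<open>The universal property of an initial topology: it suffices to test against each
  continuous \<open>f\<close>.\<close>

lemma continuous_into_weak_star:
  assumes "\<xi> ` topspace X \<subseteq> regular_measures K"
    and "\<And>f. continuous_on K f \<Longrightarrow> continuous_map X euclideanreal (\<lambda>x. signed_integral K (\<xi> x) f)"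
  shows "continuous_map X (weak_star K) \<xi>"
  unfolding weak_star_def
proof (rule continuous_map_pullback')
  show "topspace X \<subseteq> \<xi> -` regular_measures K" using assms(1) by blast
  show "continuous_map X (powertop_real {f. continuous_on K f})
      ((\<lambda>\<mu>. \<lambda>f\<in>{f. continuous_on K f}. signed_integral K \<mu> f) \<circ> \<xi>)"
    unfolding continuous_map_componentwise using assms(2) by (auto simp: o_def)
qed

text \<open>Fixing \<open>q\<close> once makes the weights and the points of the tree independent of
  \<mu>; only the masses vary with it.\<close>

locale separated_compact =
  fixes K :: "'a::metric_space set" and q :: "nat \<Rightarrow> 'a \<Rightarrow> real"
  assumes K: "compact K"
    and q_cont: "\<And>n. continuous_on K (q n)"
    and q: "\<And>n x. 0 \<le> q n x" "\<And>n x. q n x \<le> 1"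
    and q_sep: "\<And>e. 0 < e \<Longrightarrow> \<exists>N. \<forall>x\<in>K. \<forall>y\<in>K. e \<le> dist x y \<longrightarrow> (\<exists>n<N. q n x = 0 \<and> q n y = 1)"
begin

abbreviation "w \<equiv> weight q"
abbreviation "c \<equiv> node_mass K q"
abbreviation "z \<equiv> node_point K q"

definition approx where
  "approx \<mu> n f = (\<Sum>j<2 ^ n. greedy (c \<mu>) n j * f (z n j))"

text \<open>Convergence with an explicit rate: the error is the oscillation of \<open>f\<close> on
  the supports of level \<open>n\<close>, times the total mass. The rate depends on \<mu> only
  through \<open>max 0 (\<mu> K)\<close>.\<close>

definition is_limit where
  "is_limit \<mu> N \<longleftrightarrow> finite_measure N \<and> sets N = borel_sets K \<and>
    (\<forall>n d e f. continuous_on K f \<longrightarrow> narrow K q d n \<longrightarrow>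
      (\<forall>x\<in>K. \<forall>y\<in>K. dist x y \<le> d \<longrightarrow> \<bar>f x - f y\<bar> \<le> e) \<longrightarrow>
      \<bar>(\<integral>x. f x \<partial>N) - approx \<mu> n f\<bar> \<le> e * max 0 (\<mu> K))"

lemma w_nonneg: "0 \<le> w n j x"
  by (rule weight_nonneg[where q = q, OF q])

lemma w_cont: "continuous_on K (w n j)"
proof (induction n arbitrary: j)
  case 0
  show ?case by (simp add: weight.simps(1)[abs_def])
next
  case (Suc n)
  have "continuous_on K (\<lambda>x. if even j then q n x else 1 - q n x)"
    by (cases "even j") (simp_all add: q_cont continuous_on_diff)
  then show ?case
    unfolding weight.simps(2)[abs_def] by (rule continuous_on_mult[OF Suc])
qed

text \<open>Points more than \<open>d\<close> apart are separated by one of finitely many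
  \<open>q n\<close>; below all those levels no node has both in its support.\<close>

lemma ex_narrow: "0 < d \<Longrightarrow> \<exists>n. narrow K q d n"
proof -
  assume "0 < d"
  from q_sep[OF this] obtain N where
    N: "\<And>x y. x \<in> K \<Longrightarrow> y \<in> K \<Longrightarrow> d \<le> dist x y \<Longrightarrow> \<exists>n<N. q n x = 0 \<and> q n y = 1" by blast
  have "narrow K q d N"
    unfolding narrow_def
  proof (intro allI ballI impI, rule ccontr)
    fix j x y assume *: "x \<in> K" "y \<in> K" "0 < w N j x" "0 < w N j y" "\<not> dist x y \<le> d"
    then obtain n where "n < N" "q n x = 0" "q n y = 1" using N[of x y] by auto
    with weight_separated[where q = q, OF q] * show False by blast
  qed
  then show ?thesis ..
qed

text \<open>The point of a node lies in the support of the ancestor too, where the point of the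
  ancestor also lies.\<close>

lemma narrow_near:
  assumes "narrow K q d n" "n \<le> k" "x \<in> K" "0 < w k j x"
  shows "dist (z k j) (z n (j div 2 ^ (k - n))) \<le> d"
proof -
  note zk = node_point[OF assms(3,4)]
  note a = weight_ancestor[where q = q, OF q assms(2) zk(2)]
  note zn = node_point[OF zk(1) a]
  show ?thesis using assms(1) zk(1) zn a unfolding narrow_def by blast
qed

context
  fixes \<mu>
  assumes \<mu>: "\<mu> \<in> regular_measures K"
begin

lemma node_mass_nonneg: "0 \<le> c \<mu> n j"
  by (simp add: node_mass_def)

lemma node_mass_subadditive: "c \<mu> n j \<le> c \<mu> (Suc n) (2 * j) + c \<mu> (Suc n) (Suc (2 * j))"
proof -
  have "w n j = (\<lambda>x. w (Suc n) (2 * j) x + w (Suc n) (Suc (2 * j)) x)"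
    by (rule ext) (rule weight_split[symmetric])
  with signed_integral_add[OF K \<mu> w_cont w_cont]
  have "signed_integral K \<mu> (w n j) =
      signed_integral K \<mu> (w (Suc n) (2 * j)) + signed_integral K \<mu> (w (Suc n) (Suc (2 * j)))"
    by metis
  then show ?thesis by (simp add: node_mass_def del: weight.simps)
qed

lemma node_mass_0: "c \<mu> 0 0 = max 0 (\<mu> K)"
  using signed_integral_const_1[OF K \<mu>] by (simp add: node_mass_def weight.simps(1)[abs_def])

lemma greedy_le_node_mass: "greedy (c \<mu>) n j \<le> c \<mu> n j"
  by (rule greedy_le) (rule node_mass_nonneg node_mass_subadditive)+

text \<open>Positive mass forces a positive capacity, hence a nonzero integral of the weight, which
  cannot vanish on all of \<open>K\<close>.\<close>

lemma greedy_pos_support: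
  assumes "0 < greedy (c \<mu>) n j"
  obtains x where "x \<in> K" "0 < w n j x"
proof -
  have "0 < c \<mu> n j"
    using greedy_le_node_mass[of n j] assms by linarith
  then have "signed_integral K \<mu> (w n j) \<noteq> 0" by (auto simp: node_mass_def)
  then obtain x where "x \<in> K" "w n j x \<noteq> 0"
    using signed_integral_zero[OF K \<mu>] by blast
  with w_nonneg[of n j x] that show thesis by auto
qed

lemma ex_limit_measure: "\<exists>N. is_limit \<mu> N"
proof -
  let ?g = "greedy (c \<mu>)"
  have near: "dist (z k j) (z n (j div 2 ^ (k - n))) \<le> d" if "narrow K q d n" "n \<le> k" "0 < ?g k j" for n k d j
    using greedy_pos_support[OF that(3)] narrow_near[OF that(1,2)] by blast
  show ?thesis
  proof (rule tree_measure[of K ?g z])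
    show "compact K" by (rule K)
    show "0 \<le> ?g n j" for n j by (rule greedy_nonneg) (rule node_mass_nonneg)
    show "?g (Suc n) (2 * j) + ?g (Suc n) (Suc (2 * j)) = ?g n j" for n j by (rule greedy_split)
    show "z n j \<in> K" if "0 < ?g n j" for n j
      using greedy_pos_support[OF that] node_point by metis
    show "\<exists>n. \<forall>k\<ge>n. \<forall>j. 0 < ?g k j \<longrightarrow> dist (z k j) (z n (j div 2 ^ (k - n))) \<le> e" if "0 < e" for e
      using ex_narrow[OF that] near by blast
    fix N
    assume N: "finite_measure N" "sets N = borel_sets K"
      and lim: "\<And>n d e f. continuous_on K f \<Longrightarrow>
        (\<And>k j. k \<ge> n \<Longrightarrow> 0 < ?g k j \<Longrightarrow> dist (z k j) (z n (j div 2 ^ (k - n))) \<le> d) \<Longrightarrow>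
        (\<And>x y. x \<in> K \<Longrightarrow> y \<in> K \<Longrightarrow> dist x y \<le> d \<Longrightarrow> \<bar>f x - f y\<bar> \<le> e) \<Longrightarrow>
        \<bar>(\<integral>x. f x \<partial>N) - (\<Sum>j<2 ^ n. ?g n j * f (z n j))\<bar> \<le> e * ?g 0 0"
    show ?thesis
      unfolding is_limit_def
    proof (intro exI[of _ N] conjI allI impI N)
      fix n d e and f :: "'a \<Rightarrow> real"
      assume "continuous_on K f" "narrow K q d n"
        "\<forall>x\<in>K. \<forall>y\<in>K. dist x y \<le> d \<longrightarrow> \<bar>f x - f y\<bar> \<le> e"
      then show "\<bar>(\<integral>x. f x \<partial>N) - approx \<mu> n f\<bar> \<le> e * max 0 (\<mu> K)"
        using lim[of f n d e] near by (simp add: approx_def node_mass_0)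
    qed
  qed
qed

end

text \<open>Any choice serves: continuity and the compensation property are both derived from the
  bounds in \<open>is_limit\<close>.\<close>

definition limit_measure where
  "limit_measure \<mu> = (SOME N. is_limit \<mu> N)"

lemma limit_measure:
  assumes "\<mu> \<in> regular_measures K"
  shows "finite_measure (limit_measure \<mu>)" "sets (limit_measure \<mu>) = borel_sets K"
    "continuous_on K f \<Longrightarrow> narrow K q d n \<Longrightarrow>
      (\<And>x y. x \<in> K \<Longrightarrow> y \<in> K \<Longrightarrow> dist x y \<le> d \<Longrightarrow> \<bar>f x - f y\<bar> \<le> e) \<Longrightarrow>
      \<bar>(\<integral>x. f x \<partial>limit_measure \<mu>) - approx \<mu> n f\<bar> \<le> e * max 0 (\<mu> K)"
proof -
  have "is_limit \<mu> (limit_measure \<mu>)"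
    unfolding limit_measure_def by (rule someI_ex[OF ex_limit_measure[OF assms]])
  note * = this[unfolded is_limit_def]
  show "finite_measure (limit_measure \<mu>)" "sets (limit_measure \<mu>) = borel_sets K"
    using * by simp_all
  show "\<bar>(\<integral>x. f x \<partial>limit_measure \<mu>) - approx \<mu> n f\<bar> \<le> e * max 0 (\<mu> K)"
    if "continuous_on K f" "narrow K q d n"
      "\<And>x y. x \<in> K \<Longrightarrow> y \<in> K \<Longrightarrow> dist x y \<le> d \<Longrightarrow> \<bar>f x - f y\<bar> \<le> e"
    using *[THEN conjunct2, THEN conjunct2, rule_format, of f d n e] that by simp
qed

text \<open>
  The level \<open>n\<close> depends on \<open>f\<close> and \<open>e\<close> but not on \<open>\<mu>\<close>, which is what makes the limit continuous.
\<close>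

lemma ex_level:
  fixes f :: "'a \<Rightarrow> real"
  assumes f: "continuous_on K f" and e: "0 < e"
  obtains n where
    "\<And>\<mu>. \<mu> \<in> regular_measures K \<Longrightarrow> \<bar>(\<integral>x. f x \<partial>limit_measure \<mu>) - approx \<mu> n f\<bar> \<le> e * max 0 (\<mu> K)"
    "\<And>j x. x \<in> K \<Longrightarrow> 0 < w n j x \<Longrightarrow> \<bar>f (z n j) - f x\<bar> \<le> e"
proof -
  from compact_uniformly_continuous[OF f K] e obtain d where
    d: "0 < d" "\<And>x y. x \<in> K \<Longrightarrow> y \<in> K \<Longrightarrow> dist x y < d \<Longrightarrow> \<bar>f x - f y\<bar> < e"
    unfolding uniformly_continuous_on_def dist_real_def by (metis dist_commute)
  \<comment> \<open>Halving \<open>d\<close> turns the strict inequality of uniform continuity into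
    the weak one used by \<open>narrow\<close>.\<close>
  have *: "\<bar>f x - f y\<bar> \<le> e" if "x \<in> K" "y \<in> K" "dist x y \<le> d / 2" for x y
    using d(1) d(2)[OF that(1,2)] that(3) by linarith
  obtain n where n: "narrow K q (d / 2) n" using ex_narrow[of "d / 2"] d(1) by auto
  show thesis
  proof (rule that[of n])
    show "\<bar>(\<integral>x. f x \<partial>limit_measure \<mu>) - approx \<mu> n f\<bar> \<le> e * max 0 (\<mu> K)"
      if "\<mu> \<in> regular_measures K" for \<mu>
      by (rule limit_measure(3)[OF that f n *])
    show "\<bar>f (z n j) - f x\<bar> \<le> e" if "x \<in> K" "0 < w n j x" for j x
      using n node_point[OF that] that * unfolding narrow_def by blast
  qed
qed

text \<open>The mass of a node is at most the integral of its weight against the positive part, and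
  on the support \<open>f\<close> at the chosen point is at most \<open>f x + e\<close>. Summing
  over a partition of unity bounds the discrete integral.\<close>

lemma integral_limit_measure_le:
  fixes f :: "'a \<Rightarrow> real"
  assumes \<mu>: "\<mu> \<in> regular_measures K" and f: "continuous_on K f" and f0: "\<And>x. x \<in> K \<Longrightarrow> 0 \<le> f x"
  shows "(\<integral>x. f x \<partial>limit_measure \<mu>) \<le> (\<integral>x. f x \<partial>to_measure K (positive_part K \<mu>))"
proof (rule le_if_le_add_mult)
  let ?P = "to_measure K (positive_part K \<mu>)" and ?g = "greedy (c \<mu>)"
  interpret P: finite_measure ?P by (rule jordan[OF K \<mu>])
  have sp: "space ?P = K" by (rule jordan[OF K \<mu>])
  note int = integrable_jordan(1)[OF K \<mu>]
  \<comment> \<open>The constant collects two errors: \<open>max 0 (\<mu> K)\<close> from the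
    discrete approximation, and the mass of the positive part from the summand \<open>e\<close> in
    the integrand.\<close>
  show "0 \<le> max 0 (\<mu> K) + measure ?P K" by simp
  fix e :: real assume e: "0 < e"
  obtain n where n:
    "\<bar>(\<integral>x. f x \<partial>limit_measure \<mu>) - approx \<mu> n f\<bar> \<le> e * max 0 (\<mu> K)"
    "\<And>j x. x \<in> K \<Longrightarrow> 0 < w n j x \<Longrightarrow> \<bar>f (z n j) - f x\<bar> \<le> e"
    by (rule ex_level[OF f e]) (use \<mu> in blast)
  have cont: "continuous_on K (\<lambda>x. w n j x * (f x + e))" for j
    by (intro continuous_intros w_cont f)
  have "?g n j * f (z n j) \<le> (\<integral>x. w n j x * (f x + e) \<partial>?P)" for j
  proof (cases "0 < ?g n j")
    case True
    with greedy_pos_support[OF \<mu>] obtain y where y: "y \<in> K" "0 < w n j y" by blast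
    have "?g n j \<le> c \<mu> n j"
      by (rule greedy_le_node_mass[OF \<mu>])
    \<comment> \<open>The capacity is positive here, so its truncation at 0 has no effect.\<close>
    also have "\<dots> = signed_integral K \<mu> (w n j)"
      using True \<open>?g n j \<le> c \<mu> n j\<close> by (simp add: node_mass_def max_def split: if_splits)
    also have "\<dots> \<le> (\<integral>x. w n j x \<partial>?P)"
      by (rule signed_integral_le[OF K \<mu>]) (rule w_nonneg)
    finally have "?g n j * f (z n j) \<le> (\<integral>x. w n j x \<partial>?P) * f (z n j)"
      by (rule mult_right_mono) (rule f0[OF node_point(1)[OF y]])
    also have "\<dots> = (\<integral>x. w n j x * f (z n j) \<partial>?P)" by simp
    also have "\<dots> \<le> (\<integral>x. w n j x * (f x + e) \<partial>?P)"
    proof (rule integral_mono)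
      show "integrable ?P (\<lambda>x. w n j x * f (z n j))"
        by (rule int) (intro continuous_intros w_cont)
      show "integrable ?P (\<lambda>x. w n j x * (f x + e))" by (rule int[OF cont])
      fix x assume "x \<in> space ?P"
      then have x: "x \<in> K" by (simp add: sp)
      show "w n j x * f (z n j) \<le> w n j x * (f x + e)"
      proof (cases "w n j x = 0")
        case False
        with w_nonneg[of n j x] n(2)[OF x, of j] show ?thesis
          by (intro mult_left_mono) auto
      qed simp
    qed
    finally show ?thesis .
  next
    case False
    with greedy_nonneg[of "c \<mu>" n j, OF node_mass_nonneg[OF \<mu>]] have "?g n j = 0" by linarith
    moreover have "0 \<le> (\<integral>x. w n j x * (f x + e) \<partial>?P)"
      by (rule integral_nonneg_AE)
        (use e f0 in \<open>auto simp: sp intro!: mult_nonneg_nonneg w_nonneg add_nonneg_nonneg\<close>)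
    ultimately show ?thesis by simp
  qed
  then have "approx \<mu> n f \<le> (\<Sum>j<2 ^ n. \<integral>x. w n j x * (f x + e) \<partial>?P)"
    unfolding approx_def by (rule sum_mono)
  also have "\<dots> = (\<integral>x. (\<Sum>j<2 ^ n. w n j x * (f x + e)) \<partial>?P)"
    by (rule Bochner_Integration.integral_sum[symmetric]) (rule int[OF cont])
  also have "\<dots> = (\<integral>x. f x + e \<partial>?P)"
    by (simp add: sum_weight flip: sum_distrib_right)
  also have "\<dots> = (\<integral>x. f x \<partial>?P) + e * measure ?P K"
    using int[OF f] by (simp add: sp mult.commute)
  finally show "(\<integral>x. f x \<partial>limit_measure \<mu>) \<le> (\<integral>x. f x \<partial>?P) + e * (max 0 (\<mu> K) + measure ?P K)"
    using n(1) by (simp add: distrib_left)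
qed

lemma limit_measure_le:
  assumes "\<mu> \<in> regular_measures K" "A \<in> borel_sets K"
  shows "measure (limit_measure \<mu>) A \<le> positive_part K \<mu> A"
  using dominated_if_integrals_dominated[OF K assms(1) limit_measure(1,2)[OF assms(1)]
      integral_limit_measure_le[OF assms(1)] assms(2)]
  by (simp add: jordan(3)[OF K assms(1)])

lemma limit_measure_regular:
  assumes "\<mu> \<in> regular_measures K"
  shows "measure (limit_measure \<mu>) \<in> regular_measures K"
  by (rule regular_if_dominated[OF K assms limit_measure(1,2)[OF assms]])
    (simp add: limit_measure_le assms jordan(3)[OF K assms])

text \<open>The constant 1 has oscillation 0, so the error bound with \<open>e = 0\<close> is an
  exact equality. Splitting preserves mass, so every level has the total of the root.\<close>

lemma limit_measure_total:
  assumes \<mu>: "\<mu> \<in> regular_measures K"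
  shows "measure (limit_measure \<mu>) K = max 0 (\<mu> K)"
proof -
  obtain n where "narrow K q 1 n" using ex_narrow[of 1] by auto
  from limit_measure(3)[OF \<mu> _ this, of "\<lambda>_. 1" 0]
  have "measure (limit_measure \<mu>) K = approx \<mu> n (\<lambda>_. 1)"
    by (simp add: sets_eq_borel_sets_imp_space limit_measure(2)[OF \<mu>])
  also have "\<dots> = greedy (c \<mu>) 0 0"
    unfolding approx_def
    by (induction n) (simp_all add: sum_double greedy_split del: greedy.simps(2))
  finally show ?thesis by (simp add: node_mass_0[OF \<mu>])
qed

text \<open>If \<open>\<mu> K\<close> is not positive, the total mass is 0 and monotonicity makes
  the measure vanish.\<close>

lemma compensation_limit_measure:
  assumes \<mu>: "\<mu> \<in> regular_measures K"
  shows "is_compensation K \<mu> (measure (limit_measure \<mu>))"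
proof (cases "0 < \<mu> K")
  case True
  then show ?thesis
    using limit_measure_regular[OF \<mu>] limit_measure_le[OF \<mu>] limit_measure_total[OF \<mu>]
    by (simp add: is_compensation_def)
next
  case False
  interpret finite_measure "limit_measure \<mu>" by (rule limit_measure[OF \<mu>])
  have "measure (limit_measure \<mu>) A \<le> measure (limit_measure \<mu>) K" for A
    using bounded_measure[of A]
    by (simp add: sets_eq_borel_sets_imp_space limit_measure(2)[OF \<mu>])
  then have "measure (limit_measure \<mu>) = (\<lambda>_. 0)"
    using False limit_measure_total[OF \<mu>] by (auto intro!: antisym simp: fun_eq_iff)
  with False limit_measure_regular[OF \<mu>] show ?thesis
    by (simp add: is_compensation_def)
qed

lemma continuous_greedy:
  "continuous_map (weak_star K) euclideanreal (\<lambda>\<mu>. greedy (c \<mu>) n j)"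
proof -
  have c: "continuous_map (weak_star K) euclideanreal (\<lambda>\<mu>. c \<mu> n j)" for n j
    unfolding node_mass_def
    by (intro continuous_intros continuous_signed_integral w_cont) auto
  show ?thesis
  proof (induction n arbitrary: j)
    case 0
    show ?case by (simp add: c)
  next
    case (Suc n)
    show ?case
      by (cases "even j") (auto simp: Let_def intro!: continuous_intros Suc c)
  qed
qed

text \<open>For each \<open>f\<close> the discrete integrals are finite sums of continuous functions
  of \<mu>. They approximate the limit up to \<open>e\<close> times the root mass, itself
  continuous, at a level that is the same for all \<mu>.\<close>

lemma continuous_limit_measure:
  "continuous_map (weak_star K) (weak_star K) (\<lambda>\<mu>. measure (limit_measure \<mu>))"
proof (rule continuous_into_weak_star)
  show "(\<lambda>\<mu>. measure (limit_measure \<mu>)) ` topspace (weak_star K) \<subseteq> regular_measures K"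
    using limit_measure_regular by (auto simp: topspace_weak_star)
  fix f :: "'a \<Rightarrow> real" assume f: "continuous_on K f"
  show "continuous_map (weak_star K) euclideanreal
      (\<lambda>\<mu>. signed_integral K (measure (limit_measure \<mu>)) f)"
  proof (rule continuous_map_locally_uniform_limit)
    show "continuous_map (weak_star K) euclideanreal (\<lambda>\<mu>. c \<mu> 0 0)"
      using continuous_greedy[of 0 0] by simp
    fix e :: real assume e: "0 < e"
    obtain n where
      n: "\<And>\<mu>. \<mu> \<in> regular_measures K \<Longrightarrow>
        \<bar>(\<integral>x. f x \<partial>limit_measure \<mu>) - approx \<mu> n f\<bar> \<le> e * max 0 (\<mu> K)"
      by (rule ex_level[OF f e], rule that)
    have "continuous_map (weak_star K) euclideanreal (\<lambda>\<mu>. approx \<mu> n f)"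
      unfolding approx_def by (intro continuous_intros continuous_greedy) auto
    then show "\<exists>s. continuous_map (weak_star K) euclideanreal s \<and>
        (\<forall>\<mu>\<in>topspace (weak_star K).
          \<bar>signed_integral K (measure (limit_measure \<mu>)) f - s \<mu>\<bar> \<le> e * c \<mu> 0 0)"
      using n
      by (intro exI[of _ "\<lambda>\<mu>. approx \<mu> n f"])
        (simp add: topspace_weak_star node_mass_0 signed_integral_measure limit_measure(1,2))
  qed
qed

end

theorem theorem3p2:
  fixes K :: "'a::metric_space set"
  assumes "compact K"
  shows "admits_compensation_function K"
proof -
  obtain q :: "nat \<Rightarrow> 'a \<Rightarrow> real" where
    "\<And>n. continuous_on K (q n)" "\<And>n x. 0 \<le> q n x" "\<And>n x. q n x \<le> 1"
    "\<And>e. 0 < e \<Longrightarrow> \<exists>N. \<forall>x\<in>K. \<forall>y\<in>K. e \<le> dist x y \<longrightarrow> (\<exists>n<N. q n x = 0 \<and> q n y = 1)"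
    by (rule separating_sequence[OF assms]) blast
  with assms interpret separated_compact K q by unfold_locales
  show ?thesis
    unfolding admits_compensation_function_def compensation_function_def
    using continuous_limit_measure compensation_limit_measure by blast
qed

end
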